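(* Let $k$ be a positive integer and let $G$ be a connected graph with vertex set $\{v_1,\dots,v_n\}$. If $$|E(G)|>k\left(1+\max_{P\in\mathbf{P}}\sum_{v\in V(P)}\big(d_{\widehat{G}}(v)-1\big)\right),$$ where $\mathbf{P}$ is the set of all shortest paths in $S(G)$ connecting two vertices of the form $w_{ij}$, then $\mu_{\mathrm{int}}(\widehat{G})>k$.
   Context: Graphs are finite and simple; $d_H(v)$ is the degree of $v$ in $H$. A $k$-improper edge coloring of a graph $H$ is a map $\alpha:E(H)\to\mathbb{N}$ such that at most $k$ edges with a common endpoint receive the same color; it is an improper interval coloring if at every vertex the colors on incident edges form a set of consecutive integers. $\mu_{\mathrm{int}}(H)$ is the smallest $k$ such that $H$ has a $k$-improper interval edge coloring. For a graph $G$ with $V(G)=\{v_1,\dots,v_n\}$, $S(G)$ is the graph obtained by subdividing every edge: $V(S(G))=\{v_1,\dots,v_n\}\cup\{w_{ij}:v_iv_j\in E(G)\}$, $E(S(G))=\{v_iw_{ij},v_jw_{ij}:v_iv_j\in E(G)\}$. The graph $\widehat{G}$ is obtained from $S(G)$ by adding a new vertex $u$ and the edges $uw_{ij}$ for all $v_iv_j\in E(G)$. *)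

theory Defs
  imports Main
begin

record 'v graph =
  verts :: "'v set"
  edges :: "'v set set"

definition simple_graph :: "'v graph \<Rightarrow> bool" where
  "simple_graph H \<longleftrightarrow> finite (verts H) \<and> (\<forall>e\<in>edges H. e \<subseteq> verts H \<and> card e = 2)"

definition incident_edges :: "'v graph \<Rightarrow> 'v \<Rightarrow> 'v set set" where
  "incident_edges H v = {e \<in> edges H. v \<in> e}"

definition degree :: "'v graph \<Rightarrow> 'v \<Rightarrow> nat" where
  "degree H v = card (incident_edges H v)"

definition path :: "'v graph \<Rightarrow> 'v \<Rightarrow> 'v list \<Rightarrow> 'v \<Rightarrow> bool" where
  "path H x p y \<longleftrightarrow> p \<noteq> [] \<and> hd p = x \<and> last p = y \<and> set p \<subseteq> verts H \<and> distinct p \<and>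
     (\<forall>i. Suc i < length p \<longrightarrow> {p ! i, p ! Suc i} \<in> edges H)"

definition shortest_path :: "'v graph \<Rightarrow> 'v \<Rightarrow> 'v list \<Rightarrow> 'v \<Rightarrow> bool" where
  "shortest_path H x p y \<longleftrightarrow> path H x p y \<and> (\<forall>q. path H x q y \<longrightarrow> length p \<le> length q)"

definition connected_graph :: "'v graph \<Rightarrow> bool" where
  "connected_graph H \<longleftrightarrow> verts H \<noteq> {} \<and> (\<forall>x\<in>verts H. \<forall>y\<in>verts H. \<exists>p. path H x p y)"

definition improper_edge_coloring :: "nat \<Rightarrow> 'v graph \<Rightarrow> ('v set \<Rightarrow> nat) \<Rightarrow> bool" where
  "improper_edge_coloring k H \<alpha> \<longleftrightarrow>
     (\<forall>v\<in>verts H. \<forall>c. card {e \<in> incident_edges H v. \<alpha> e = c} \<le> k)"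

(* Isolated vertices have an empty set of colors, which is the interval {a..b} with a > b. *)
definition interval_coloring :: "'v graph \<Rightarrow> ('v set \<Rightarrow> nat) \<Rightarrow> bool" where
  "interval_coloring H \<alpha> \<longleftrightarrow> (\<forall>v\<in>verts H. \<exists>a b. \<alpha> ` incident_edges H v = {a..b})"

definition mu_int :: "'v graph \<Rightarrow> nat" where
  "mu_int H = (LEAST k. \<exists>\<alpha>. improper_edge_coloring k H \<alpha> \<and> interval_coloring H \<alpha>)"

(* Vertices of S(G) and of its extension: Orig v is a vertex v of G, Sub e is the vertex
   w_ij subdividing e = {v_i, v_j}, and Apex is the additional vertex u. *)
datatype 'v hat_vertex = Orig 'v | Sub "'v set" | Apex

definition subdivision :: "'v graph \<Rightarrow> 'v hat_vertex graph" where
  "subdivision G =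
     \<lparr>verts = Orig ` verts G \<union> Sub ` edges G,
      edges = {{Orig v, Sub e} |v e. e \<in> edges G \<and> v \<in> e}\<rparr>"

definition hat_graph :: "'v graph \<Rightarrow> 'v hat_vertex graph" where
  "hat_graph G =
     \<lparr>verts = insert Apex (verts (subdivision G)),
      edges = edges (subdivision G) \<union> {{Apex, Sub e} |e. e \<in> edges G}\<rparr>"

(* Empty when G has at most one edge. A maximum over it is then an unspecified natural number m,
   which is harmless in a hypothesis |E(G)| > k * (1 + m) with k > 0, as that fails for every m. *)
definition subdivision_geodesics :: "'v graph \<Rightarrow> 'v hat_vertex list set" where
  "subdivision_geodesics G =
     {p. \<exists>e\<in>edges G. \<exists>f\<in>edges G. e \<noteq> f \<and> shortest_path (subdivision G) (Sub e) p (Sub f)}"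

(* The natural-number subtraction never truncates for such a path: each of its vertices has
   positive degree in the extended graph. *)
definition path_weight :: "'v graph \<Rightarrow> 'v hat_vertex list \<Rightarrow> nat" where
  "path_weight G p = (\<Sum>v\<in>set p. degree (hat_graph G) v - 1)"

lemma finite_edges: "simple_graph H \<Longrightarrow> finite (edges H)"
  unfolding simple_graph_def by (meson Pow_iff finite_Pow_iff rev_finite_subset subsetI)

lemma simple_graph_subdivision: "simple_graph G \<Longrightarrow> simple_graph (subdivision G)"
  using finite_edges[of G] by (auto simp: simple_graph_def subdivision_def)

lemma simple_graph_hat_graph: "simple_graph G \<Longrightarrow> simple_graph (hat_graph G)"
  using simple_graph_subdivision[of G]
  by (auto simp: simple_graph_def hat_graph_def) (auto simp: subdivision_def)

lemma mu_int_attained: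
  assumes "simple_graph H"
  shows "\<exists>\<alpha>. improper_edge_coloring (mu_int H) H \<alpha> \<and> interval_coloring H \<alpha>"
proof -
  have "card {e \<in> incident_edges H v. (0::nat) = c} \<le> card (edges H)" for v c
    by (rule card_mono) (auto simp: finite_edges[OF assms] incident_edges_def)
  moreover have "\<exists>a b. (\<lambda>_. 0::nat) ` incident_edges H v = {a..b}" for v
  proof (cases "incident_edges H v = {}")
    case True
    then have "(\<lambda>_. 0::nat) ` incident_edges H v = {1..0}" by simp
    then show ?thesis by blast
  next
    case False
    then have "(\<lambda>_. 0::nat) ` incident_edges H v = {0..0}" by auto
    then show ?thesis by blast
  qed
  ultimately have "improper_edge_coloring (card (edges H)) H (\<lambda>_. 0) \<and> interval_coloring H (\<lambda>_. 0)"
    by (simp add: improper_edge_coloring_def interval_coloring_def)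
  then have "\<exists>k \<alpha>. improper_edge_coloring k H \<alpha> \<and> interval_coloring H \<alpha>"
    by blast
  then show ?thesis
    unfolding mu_int_def by (rule LeastI_ex)
qed

lemma finite_subdivision_geodesics:
  assumes "simple_graph G"
  shows "finite (subdivision_geodesics G)"
proof -
  have fin: "finite (verts (subdivision G))"
    using simple_graph_subdivision[OF assms] by (simp add: simple_graph_def)
  have "subdivision_geodesics G \<subseteq> {p. set p \<subseteq> verts (subdivision G) \<and> distinct p}"
    by (auto simp: subdivision_geodesics_def shortest_path_def path_def)
  then show ?thesis
    using finite_subset finite_subset_distinct[OF fin] by blast
qed

end

theory Submission
  imports Defs
begin

text \<open>
  The colors at the apex form an interval and each of them is used at most \<open>k\<close> times, so
  two of these colors differ by at least \<open>|E(G)| / k - 1\<close>. Join the two subdivision vertices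
  carrying such a pair of edges by a shortest path of \<open>S(G)\<close>. Two edges with a common
  endpoint \<open>v\<close> have colors differing by at most \<open>d(v) - 1\<close>, so walking from one apex edge
  to the other along this path changes the color by at most the weight of the path.
\<close>

text \<open>Unlike the indexed adjacency condition in \<open>path\<close>,
  \<open>successively\<close> splits along \<open>@\<close> and \<open>#\<close>, which suits
  cutting, extending and induction.\<close>

lemma path_iff_successively:
  "path H x p y \<longleftrightarrow> p \<noteq> [] \<and> hd p = x \<and> last p = y \<and> set p \<subseteq> verts H \<and> distinct p \<and>
     successively (\<lambda>a b. {a, b} \<in> edges H) p"
  by (auto simp: path_def successively_conv_nth)

lemma path_prefix:
  assumes "path H x (ps @ z # qs) y"
  shows "path H x (ps @ [z]) z"
proof -
  have "hd (ps @ [z]) = hd (ps @ z # qs)"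
    by (cases ps) auto
  then show ?thesis
    using assms by (auto simp: path_iff_successively successively_append_iff)
qed

lemma path_snoc:
  assumes "path H x p y" "{y, z} \<in> edges H" "z \<in> verts H" "z \<notin> set p"
  shows "path H x (p @ [z]) z"
  using assms by (auto simp: path_iff_successively successively_append_iff)

text \<open>Reachability is transitive, whereas two concatenated paths may fail to be
  \<open>distinct\<close>. Paths are therefore assembled through the closure and recovered from it
  here.\<close>

lemma rtrancl_imp_path:
  assumes "simple_graph H" "x \<in> verts H" "(x, y) \<in> {(a, b). {a, b} \<in> edges H}\<^sup>*"
  shows "\<exists>p. path H x p y"
  using assms(3)
proof (induction rule: rtrancl_induct)
  case base
  have "path H x [x] x"
    using assms(2) by (simp add: path_def)
  then show ?case ..
next
  case (step y z)
  then obtain p where p: "path H x p y" by blast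
  show ?case
  proof (cases "z \<in> set p")
    \<comment> \<open>Extending \<open>p\<close> would repeat \<open>z\<close>, so \<open>p\<close>
      is cut off at its visit to \<open>z\<close>.\<close>
    case True
    then obtain ps qs where "p = ps @ z # qs"
      by (meson split_list)
    with p show ?thesis
      using path_prefix by metis
  next
    case False
    moreover have "{y, z} \<in> edges H" "z \<in> verts H"
      using step.hyps(2) assms(1) by (auto simp: simple_graph_def)
    ultimately show ?thesis
      using p path_snoc by metis
  qed
qed

lemma path_imp_rtrancl:
  assumes "path H x p y"
  shows "(x, y) \<in> {(a, b). {a, b} \<in> edges H}\<^sup>*"
proof -
  have "successively (\<lambda>a b. {a, b} \<in> edges H) p \<Longrightarrow> p \<noteq> [] \<Longrightarrow>
      (hd p, last p) \<in> {(a, b). {a, b} \<in> edges H}\<^sup>*" for p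
    by (induction p rule: induct_list012) (auto intro: converse_rtrancl_into_rtrancl)
  then show ?thesis
    using assms by (auto simp: path_iff_successively)
qed

lemma path_imp_shortest_path:
  assumes "path H x p y"
  shows "\<exists>q. shortest_path H x q y"
  using ex_has_least_nat[of "\<lambda>q. path H x q y" p length] assms
  by (auto simp: shortest_path_def)

lemma subdivision_edge_iff:
  "{Orig v, Sub e} \<in> edges (subdivision G) \<longleftrightarrow> e \<in> edges G \<and> v \<in> e"
  by (auto simp: subdivision_def doubleton_eq_iff)

text \<open>An edge ab of \<open>G\<close> becomes the two steps from a over
  \<open>Sub {a, b}\<close> to b, so reachability lifts from \<open>G\<close>. It remains to step
  from \<open>Sub e\<close> to an endpoint of \<open>e\<close>, and from an endpoint of
  \<open>f\<close> to \<open>Sub f\<close>.\<close>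

lemma shortest_path_subdivision:
  assumes "simple_graph G" "connected_graph G" "e \<in> edges G" "f \<in> edges G"
  shows "\<exists>p. shortest_path (subdivision G) (Sub e) p (Sub f)"
proof -
  let ?R = "{(a, b). {a, b} \<in> edges (subdivision G)}"
  have sym: "{Sub g, Orig v} \<in> edges (subdivision G) \<longleftrightarrow> g \<in> edges G \<and> v \<in> g" for g v
    by (simp add: insert_commute subdivision_edge_iff)
  have edge: "(Orig a, Orig b) \<in> ?R\<^sup>*" if "{a, b} \<in> edges G" for a b
  proof -
    have "(Orig a, Sub {a, b}) \<in> ?R" "(Sub {a, b}, Orig b) \<in> ?R"
      using that by (auto simp: subdivision_edge_iff sym)
    then show ?thesis by (meson r_into_rtrancl rtrancl_trans)
  qed
  have lift: "(Orig x, Orig y) \<in> ?R\<^sup>*" if "(x, y) \<in> {(a, b). {a, b} \<in> edges G}\<^sup>*" for x y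
    using that by induction (use edge in \<open>auto intro: rtrancl_trans\<close>)
  have "e \<noteq> {}" "f \<noteq> {}"
    using assms by (auto simp: simple_graph_def)
  then obtain x y where xy: "x \<in> e" "y \<in> f" by blast
  then have "x \<in> verts G" "y \<in> verts G"
    using assms by (auto simp: simple_graph_def)
  then have "(Orig x, Orig y) \<in> ?R\<^sup>*"
    using assms(2) lift path_imp_rtrancl unfolding connected_graph_def by metis
  moreover have "(Sub e, Orig x) \<in> ?R" "(Orig y, Sub f) \<in> ?R"
    using xy assms by (auto simp: subdivision_edge_iff sym)
  ultimately have "(Sub e, Sub f) \<in> ?R\<^sup>*"
    by (meson r_into_rtrancl rtrancl_trans)
  moreover have "Sub e \<in> verts (subdivision G)"
    using assms(3) by (simp add: subdivision_def)
  ultimately show ?thesis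
    using rtrancl_imp_path simple_graph_subdivision[OF assms(1)] path_imp_shortest_path by metis
qed

text \<open>An interval of colors has no gaps, and it has at most as many elements as there are
  edges at \<open>v\<close>.\<close>

lemma interval_coloring_incident_le:
  assumes "simple_graph H" "interval_coloring H \<alpha>" "v \<in> verts H"
    and "e \<in> incident_edges H v" "f \<in> incident_edges H v"
  shows "\<alpha> f \<le> \<alpha> e + (degree H v - 1)"
proof -
  obtain a b where ab: "\<alpha> ` incident_edges H v = {a..b}"
    using assms(2,3) unfolding interval_coloring_def by blast
  have "finite (incident_edges H v)"
    using finite_edges[OF assms(1)] by (simp add: incident_edges_def)
  then have "card {a..b} \<le> degree H v"
    unfolding degree_def ab[symmetric] by (rule card_image_le)
  moreover have "\<alpha> e \<in> {a..b}" "\<alpha> f \<in> {a..b}"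
    using assms(4,5) ab by blast+
  ultimately show ?thesis by auto
qed

text \<open>The edges \<open>e\<close> and \<open>f\<close> need not lie on the path: they only
  enter it at \<open>x\<close> and leave it at \<open>y\<close>. Hence both end vertices contribute
  to the sum as well.\<close>

lemma interval_coloring_path_le:
  assumes "simple_graph H" "interval_coloring H \<alpha>" "path H x p y"
    and "e \<in> incident_edges H x" "f \<in> incident_edges H y"
  shows "\<alpha> f \<le> \<alpha> e + (\<Sum>v\<in>set p. degree H v - 1)"
  using assms(3,4)
proof (induction p arbitrary: x e)
  case Nil
  then show ?case by (simp add: path_def)
next
  case (Cons v q)
  have v: "v = x" "x \<in> verts H"
    using Cons.prems by (auto simp: path_def)
  show ?case
  proof (cases q)
    case Nil
    then have "y = x"
      using Cons.prems v by (simp add: path_def)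
    then show ?thesis
      using interval_coloring_incident_le[OF assms(1,2)] Cons.prems(2) assms(5) v Nil by simp
  next
    case (Cons w r)
    then have q: "path H w q y" and vw: "{v, w} \<in> edges H" and "v \<notin> set q"
      using Cons.prems by (auto simp: path_iff_successively)
    \<comment> \<open>The first edge of the path takes over the role of \<open>e\<close> for the
      remaining path, which is why the induction generalizes \<open>e\<close>.\<close>
    have "\<alpha> f \<le> \<alpha> {v, w} + (\<Sum>v\<in>set q. degree H v - 1)"
      using Cons.IH[OF q] vw by (simp add: incident_edges_def)
    moreover have "\<alpha> {v, w} \<le> \<alpha> e + (degree H v - 1)"
      using interval_coloring_incident_le[OF assms(1,2), of v e "{v, w}"] Cons.prems(2) v vw
      by (simp add: incident_edges_def)
    ultimately show ?thesis
      using \<open>v \<notin> set q\<close> by simp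
  qed
qed

text \<open>Pigeonhole: the color classes at \<open>v\<close> partition its edges into sets of size
  at most \<open>k\<close>, so more than \<open>1 + m\<close> colors occur, and they are
  consecutive.\<close>

lemma interval_coloring_spread:
  assumes "simple_graph H" "improper_edge_coloring k H \<alpha>" "interval_coloring H \<alpha>"
    and "v \<in> verts H" "degree H v > k * (1 + m)"
  obtains e f where "e \<in> incident_edges H v" "f \<in> incident_edges H v" "\<alpha> f > \<alpha> e + m"
proof -
  let ?I = "incident_edges H v"
  obtain a b where ab: "\<alpha> ` ?I = {a..b}"
    using assms(3,4) unfolding interval_coloring_def by blast
  have fin: "finite ?I"
    using finite_edges[OF assms(1)] by (simp add: incident_edges_def)
  have "card ?I = (\<Sum>c\<in>\<alpha> ` ?I. card {e \<in> ?I. \<alpha> e = c})"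
    using sum.image_gen[OF fin, of "\<lambda>_. 1::nat" \<alpha>] by simp
  also have "\<dots> \<le> (\<Sum>c\<in>\<alpha> ` ?I. k)"
    using assms(2,4) by (intro sum_mono) (simp add: improper_edge_coloring_def)
  also have "\<dots> = k * (Suc b - a)"
    by (simp add: ab)
  finally have "k * (1 + m) < k * (Suc b - a)"
    using assms(5) by (simp add: degree_def)
  then have "1 + m < Suc b - a"
    unfolding mult_less_cancel1 by blast
  \<comment> \<open>The truncated difference is positive, so \<open>{a..b}\<close> is nonempty and
    both of its ends are colors at \<open>v\<close>.\<close>
  then have gt: "b > a + m"
    by simp
  then have "a \<in> \<alpha> ` ?I" "b \<in> \<alpha> ` ?I"
    unfolding ab by auto
  with gt show thesis
    using that by blast
qed

lemma improper_edge_coloring_mono: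
  "improper_edge_coloring k H \<alpha> \<Longrightarrow> k \<le> l \<Longrightarrow> improper_edge_coloring l H \<alpha>"
  unfolding improper_edge_coloring_def using le_trans by blast

lemma path_subdivision_imp_path_hat_graph:
  "path (subdivision G) x p y \<Longrightarrow> path (hat_graph G) x p y"
  by (auto simp: path_def hat_graph_def)

lemma incident_edges_Apex: "incident_edges (hat_graph G) Apex = (\<lambda>e. {Apex, Sub e}) ` edges G"
  by (auto simp: incident_edges_def hat_graph_def subdivision_def)

lemma degree_Apex: "degree (hat_graph G) Apex = card (edges G)"
  unfolding degree_def incident_edges_Apex
  by (rule card_image) (auto simp: inj_on_def doubleton_eq_iff)

theorem theorem10:
  fixes G :: "'v graph" and k :: nat
  assumes "k > 0"
    and "simple_graph G"
    and "connected_graph G"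
    and "card (edges G) > k * (1 + (MAX p\<in>subdivision_geodesics G. path_weight G p))"
  shows "mu_int (hat_graph G) > k"
proof (rule ccontr)
  assume "\<not> mu_int (hat_graph G) > k"
  let ?H = "hat_graph G"
  define m where "m = (MAX p\<in>subdivision_geodesics G. path_weight G p)"
  have H: "simple_graph ?H"
    by (rule simple_graph_hat_graph[OF assms(2)])
  obtain \<alpha> where "improper_edge_coloring (mu_int ?H) ?H \<alpha>" and int: "interval_coloring ?H \<alpha>"
    using mu_int_attained[OF H] by blast
  then have imp: "improper_edge_coloring k ?H \<alpha>"
    using improper_edge_coloring_mono \<open>\<not> mu_int ?H > k\<close> by (metis not_less)
  have "Apex \<in> verts ?H"
    by (simp add: hat_graph_def)
  moreover have "degree ?H Apex > k * (1 + m)"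
    using assms(4) by (simp add: degree_Apex m_def)
  ultimately obtain e' f' where "e' \<in> incident_edges ?H Apex" "f' \<in> incident_edges ?H Apex"
    and "\<alpha> f' > \<alpha> e' + m"
    using interval_coloring_spread[OF H imp int] by blast
  then obtain e f where e: "e \<in> edges G" and f: "f \<in> edges G"
    and gt: "\<alpha> {Apex, Sub f} > \<alpha> {Apex, Sub e} + m"
    by (auto simp: incident_edges_Apex)
  obtain p where p: "shortest_path (subdivision G) (Sub e) p (Sub f)"
    using shortest_path_subdivision[OF assms(2,3) e f] by blast
  \<comment> \<open>Distinctness puts \<open>p\<close> among the geodesics over which the maximum is
    taken, so this set is nonempty and \<open>m\<close> is a genuine maximum.\<close>
  have "e \<noteq> f"
    using gt by auto
  then have "p \<in> subdivision_geodesics G"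
    using e f p by (auto simp: subdivision_geodesics_def)
  then have "path_weight G p \<le> m"
    unfolding m_def using finite_subdivision_geodesics[OF assms(2)] by simp
  moreover have "path ?H (Sub e) p (Sub f)"
    using p by (simp add: shortest_path_def path_subdivision_imp_path_hat_graph)
  \<comment> \<open>The two apex edges serve as the entering and leaving edges, since they meet the
    path at its ends \<open>Sub e\<close> and \<open>Sub f\<close>.\<close>
  then have "\<alpha> {Apex, Sub f} \<le> \<alpha> {Apex, Sub e} + path_weight G p"
    unfolding path_weight_def
    by (rule interval_coloring_path_le[OF H int])
      (use e f in \<open>auto simp: incident_edges_def hat_graph_def\<close>)
  ultimately show False
    using gt by simp
qed

end
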